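(* Let $T$ be a functional non-deterministic register transducer with $k$ registers, defining the function $f$. Then for every $X\subseteq\mathcal{D}$ with $|X|\geq2k+3$ and $d_0\in X$: $f$ is not continuous at some $x\in(\Sigma\times\mathcal{D})^\omega$ if and only if $f$ is not continuous at some $z\in(\Sigma\times X)^\omega$.
   Context: Fix finite alphabets $\Sigma,\Gamma$, a countably infinite set $\mathcal{D}$ of data values and a distinguished $d_0\in\mathcal{D}$. A test over a finite register set $R$ is a Boolean combination of $\top,\bot,r^{=},r^{\neq}$ ($r\in R$); for $\tau:R\to\mathcal{D}$ and $d\in\mathcal{D}$, $\tau,d\models r^{=}$ iff $\tau(r)=d$, $\tau,d\models r^{\neq}$ iff $\tau(r)\neq d$. A non-deterministic register transducer (NRT) is $T=(Q,R,i_0,F,\Delta)$ with finite states $Q$, initial $i_0$, accepting $F\subseteq Q$, finite register set $R$ ($k=|R|$), and finite $\Delta\subseteq Q\times\Sigma\times\mathrm{Tests}_R\times2^R\times(\Gamma\times R)^*\times Q$. From configuration $(q,\tau)$, reading $(\sigma,d)$, a transition $(q,\sigma,\phi,\mathrm{asgn},o,q')$ with $\tau,d\models\phi$ leads to $(q',\tau')$ with $\tau'(r)=d$ if $r\in\mathrm{asgn}$ and $\tau'(r)=\tau(r)$ otherwise, outputting $(\gamma_1,\tau'(r_1))\cdots(\gamma_m,\tau'(r_m))$ where $o=(\gamma_1,r_1)\cdots(\gamma_m,r_m)$. An accepting run starts in $i_0$ with all registers equal to $d_0$ and visits $F$ infinitely often; standing assumption: accepting runs produce infinite outputs. $T$ is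 functional if the set of (input, output) pairs of accepting runs is the graph of a partial function $f$. $f$ is continuous at $x\in\mathrm{dom}(f)$ if for all $i\geq0$ there is $j\geq0$ such that for all $y\in\mathrm{dom}(f)$, $|x\wedge y|\geq j$ implies $|f(x)\wedge f(y)|\geq i$, where $\wedge$ is longest common prefix; "not continuous at $x$" is only meant for $x\in\mathrm{dom}(f)$. *)

theory Defs
  imports Main "HOL-Library.Omega_Words_Fun" "HOL-Library.Countable"
    "HOL-Library.Extended_Nat" "HOL-Library.Infinite_Typeclass"
begin

datatype (test_regs: 'r) test =
    Top
  | Bot
  | EqReg 'r
  | NeqReg 'r
  | Neg "'r test"
  | Conj "'r test" "'r test"
  | Disj "'r test" "'r test"

primrec sat :: "('r \<Rightarrow> 'd) \<Rightarrow> 'd \<Rightarrow> 'r test \<Rightarrow> bool" where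
  "sat \<tau> d Top \<longleftrightarrow> True"
| "sat \<tau> d Bot \<longleftrightarrow> False"
| "sat \<tau> d (EqReg r) \<longleftrightarrow> \<tau> r = d"
| "sat \<tau> d (NeqReg r) \<longleftrightarrow> \<tau> r \<noteq> d"
| "sat \<tau> d (Neg \<phi>) \<longleftrightarrow> \<not> sat \<tau> d \<phi>"
| "sat \<tau> d (Conj \<phi> \<psi>) \<longleftrightarrow> sat \<tau> d \<phi> \<and> sat \<tau> d \<psi>"
| "sat \<tau> d (Disj \<phi> \<psi>) \<longleftrightarrow> sat \<tau> d \<phi> \<or> sat \<tau> d \<psi>"

type_synonym ('q, 'r, 'a, 'b) transition =
  "'q \<times> 'a \<times> 'r test \<times> 'r set \<times> ('b \<times> 'r) list \<times> 'q"

record ('q, 'r, 'a, 'b) transducer =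
  states :: "'q set"
  regs :: "'r set"
  init :: 'q
  acc :: "'q set"
  trans :: "('q, 'r, 'a, 'b) transition set"

definition is_nrt :: "('q, 'r, 'a::finite, 'b::finite) transducer \<Rightarrow> bool" where
  "is_nrt T \<longleftrightarrow>
     finite (states T) \<and> finite (regs T) \<and> init T \<in> states T \<and> acc T \<subseteq> states T \<and>
     finite (trans T) \<and>
     trans T \<subseteq> states T \<times> UNIV \<times> {\<phi>. test_regs \<phi> \<subseteq> regs T} \<times> Pow (regs T)
                \<times> lists (UNIV \<times> regs T) \<times> states T"

text \<open>
  Valuations are total functions on the type of registers; for a well-formed transducer only
  their restriction to \<open>regs T\<close> is ever tested, updated or output.
\<close>

type_synonym ('q, 'r, 'd) config = "'q \<times> ('r \<Rightarrow> 'd)"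

inductive step :: "('q, 'r, 'a, 'b) transducer \<Rightarrow> ('q, 'r, 'd) config \<Rightarrow> 'a \<times> 'd
    \<Rightarrow> ('b \<times> 'd) list \<Rightarrow> ('q, 'r, 'd) config \<Rightarrow> bool"
  for T where
  "\<lbrakk> (q, \<sigma>, \<phi>, A, w, q') \<in> trans T; sat \<tau> d \<phi>; \<tau>' = (\<lambda>r. if r \<in> A then d else \<tau> r) \<rbrakk>
   \<Longrightarrow> step T (q, \<tau>) (\<sigma>, d) (map (\<lambda>(\<gamma>, r). (\<gamma>, \<tau>' r)) w) (q', \<tau>')"

definition accepting_run :: "('q, 'r, 'a, 'b) transducer \<Rightarrow> 'd \<Rightarrow> ('a \<times> 'd) word
    \<Rightarrow> (nat \<Rightarrow> ('q, 'r, 'd) config) \<Rightarrow> (nat \<Rightarrow> ('b \<times> 'd) list) \<Rightarrow> bool" where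
  "accepting_run T d0 x c v \<longleftrightarrow>
     c 0 = (init T, \<lambda>_. d0) \<and>
     (\<forall>n. step T (c n) (x n) (v n) (c (Suc n))) \<and>
     (\<exists>\<^sub>\<infinity>n. fst (c n) \<in> acc T)"

definition infinite_output :: "(nat \<Rightarrow> 'c list) \<Rightarrow> bool" where
  "infinite_output v \<longleftrightarrow> (\<forall>m. \<exists>n. m \<le> length (concat (prefix n v)))"

text \<open>\<open>y\<close> is the infinite concatenation \<open>v 0 @ v 1 @ \<dots>\<close>.\<close>

definition is_concat :: "(nat \<Rightarrow> 'c list) \<Rightarrow> 'c word \<Rightarrow> bool" where
  "is_concat v y \<longleftrightarrow> infinite_output v \<and>
     (\<forall>n. concat (prefix n v) = prefix (length (concat (prefix n v))) y)"

definition productive :: "('q, 'r, 'a, 'b) transducer \<Rightarrow> 'd \<Rightarrow> bool" where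
  "productive T d0 \<longleftrightarrow> (\<forall>x c v. accepting_run T d0 x c v \<longrightarrow> infinite_output v)"

definition behaviour :: "('q, 'r, 'a, 'b) transducer \<Rightarrow> 'd
    \<Rightarrow> (('a \<times> 'd) word \<times> ('b \<times> 'd) word) set" where
  "behaviour T d0 = {(x, y). \<exists>c v. accepting_run T d0 x c v \<and> is_concat v y}"

definition defines_fun :: "('q, 'r, 'a, 'b) transducer \<Rightarrow> 'd
    \<Rightarrow> (('a \<times> 'd) word \<rightharpoonup> ('b \<times> 'd) word) \<Rightarrow> bool" where
  "defines_fun T d0 f \<longleftrightarrow> behaviour T d0 = Map.graph f"

text \<open>The length of the longest common prefix, which is \<open>\<infinity>\<close> for equal words.\<close>

definition lcp_length :: "'c word \<Rightarrow> 'c word \<Rightarrow> enat" where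
  "lcp_length x y = (SUP n \<in> {n. prefix n x = prefix n y}. enat n)"

text \<open>Only meaningful for \<open>x \<in> dom f\<close>.\<close>

definition continuous_at :: "('c word \<rightharpoonup> 'e word) \<Rightarrow> 'c word \<Rightarrow> bool" where
  "continuous_at f x \<longleftrightarrow>
     (\<forall>i. \<exists>j. \<forall>y \<in> dom f. lcp_length x y \<ge> enat j \<longrightarrow>
        lcp_length (the (f x)) (the (f y)) \<ge> enat i)"

end

theory Submission
  imports Defs "HOL-Combinatorics.Transposition"
begin

text \<open>
  Suppose \<open>f\<close> is discontinuous at \<open>x\<close>. Then there is an output position \<open>m\<close> such that inputs
  arbitrarily close to \<open>x\<close> have an image differing from \<open>f x\<close> at \<open>m\<close>. By Koenig's lemma, some run
  on \<open>x\<close>, not necessarily accepting, has arbitrarily long prefixes in common with accepting runs on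
  such inputs. We rename the data along the accepting run on \<open>x\<close> and along this limit run
  simultaneously, by injections \<open>h n\<close> such that \<open>h (n + 1)\<close> agrees with \<open>h n\<close> on the values that
  matter at time \<open>n\<close>: the contents of the \<open>2 * k\<close> registers, the value \<open>d0\<close>, and the data value
  \<open>d\<close> of \<open>f x\<close> at \<open>m\<close>. These are at most \<open>2 * k + 2\<close> values, so \<open>2 * k + 3\<close> values suffice for
  the renamed input \<open>z\<close>. Applying \<open>h 0, \<dots>, h j, h j, h j, \<dots>\<close> to an accepting run that shares
  its first \<open>j\<close> steps with the limit run yields an input that is \<open>j\<close>-close to \<open>z\<close>. Since all
  \<open>h n\<close> are injective and agree on \<open>d\<close>, the mismatch at \<open>m\<close> persists.
\<close>

section \<open>Infinite words\<close>

lemma prefix_eq_iff: "prefix n x = prefix n y \<longleftrightarrow> (\<forall>i<n. x i = y i)"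
  by (auto simp: list_eq_iff_nth_eq)

lemma enat_le_lcp_length_iff: "enat j \<le> lcp_length x y \<longleftrightarrow> (\<forall>i<j. x i = y i)"
proof
  assume j: "enat j \<le> lcp_length x y"
  show "\<forall>i<j. x i = y i"
  proof (intro allI impI)
    fix i assume "i < j"
    then have "enat i < lcp_length x y"
      using j by (meson enat_ord_simps(2) less_le_trans)
    then obtain n where "i < n" "prefix n x = prefix n y"
      by (auto simp: lcp_length_def less_SUP_iff)
    then show "x i = y i"
      by (auto simp: prefix_eq_iff)
  qed
next
  assume "\<forall>i<j. x i = y i"
  then show "enat j \<le> lcp_length x y"
    unfolding lcp_length_def by (intro SUP_upper) (auto simp: prefix_eq_iff)
qed

text \<open>Agreement up to \<open>i\<close> concerns finitely many positions, and the sum of their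
  moduli serves them all. Negated, this gives one output position at which inputs arbitrarily close
  to \<open>x\<close> mismatch.\<close>

lemma continuous_at_pointwise:
  "continuous_at f x \<longleftrightarrow>
    (\<forall>m. \<exists>j. \<forall>y\<in>dom f. (\<forall>i<j. x i = y i) \<longrightarrow> the (f x) m = the (f y) m)"
    (is "_ = (\<forall>m. \<exists>j. ?P m j)")
proof
  assume "continuous_at f x"
  then show "\<forall>m. \<exists>j. ?P m j"
    unfolding continuous_at_def enat_le_lcp_length_iff by (metis lessI)
next
  assume "\<forall>m. \<exists>j. ?P m j"
  then obtain J where J: "\<And>m. ?P m (J m)"
    by metis
  have "\<forall>y\<in>dom f. (\<forall>l<(\<Sum>m<i. J m). x l = y l) \<longrightarrow> (\<forall>m<i. the (f x) m = the (f y) m)" for i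
  proof (intro ballI impI allI)
    fix y m
    assume y: "y \<in> dom f" "\<forall>l<(\<Sum>m<i. J m). x l = y l" and "m < i"
    then have "J m \<le> (\<Sum>m<i. J m)"
      by (intro member_le_sum) auto
    then show "the (f x) m = the (f y) m"
      using J y by auto
  qed
  then show "continuous_at f x"
    unfolding continuous_at_def enat_le_lcp_length_iff by blast
qed

text \<open>Koenig's lemma for the tree of prefixes common to all \<open>S j\<close>. Finiteness of
  letter \<open>n\<close> is asked on \<open>S (Suc n)\<close> only, and the limit \<open>w\<close>
  may lie in no \<open>S j\<close>.\<close>

lemma koenig_sequences:
  fixes S :: "nat \<Rightarrow> 'e word set"
  assumes dec: "\<And>i j. i \<le> j \<Longrightarrow> S j \<subseteq> S i"
    and ne: "\<And>j. S j \<noteq> {}"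
    and fin: "\<And>n. finite ((\<lambda>w. w n) ` S (Suc n))"
  obtains w where "\<And>j. \<exists>u\<in>S j. \<forall>n<j. u n = w n"
proof -
  let ?P = "\<lambda>n p. \<forall>j. \<exists>u\<in>S j. prefix n u = p"
  have step: "\<exists>q. ?P (Suc n) q \<and> (\<exists>a. q = p @ [a])" if p: "?P n p" for n p
  proof -
    obtain u where u: "\<And>j. u j \<in> S j" "\<And>j. prefix n (u j) = p"
      using p by metis
    \<comment> \<open>The shift puts each word into \<open>S (Suc n)\<close>, where letter
      \<open>n\<close> has finitely many values; one of them recurs for arbitrarily large
      \<open>j\<close>.\<close>
    let ?g = "\<lambda>j. u (j + Suc n) n"
    have "range ?g \<subseteq> (\<lambda>w. w n) ` S (Suc n)"
      using u(1) dec[OF le_add2] by (blast intro: image_eqI)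
    then have fin_range: "finite (range ?g)"
      using fin finite_subset by blast
    then obtain j0 where inf: "infinite {j. ?g j = ?g j0}"
      using pigeonhole_infinite[OF infinite_UNIV_nat fin_range] by auto
    have "?P (Suc n) (p @ [?g j0])"
    proof
      fix j
      obtain i where i: "i \<ge> j" "?g i = ?g j0"
        using inf by (auto simp: infinite_nat_iff_unbounded_le)
      have "u (i + Suc n) \<in> S j"
        using u(1) dec i(1) by (meson le_add1 le_trans subsetD)
      then show "\<exists>u\<in>S j. prefix (Suc n) u = p @ [?g j0]"
        using i(2) u(2)[of "i + Suc n"] by (intro bexI) auto
    qed
    then show ?thesis
      by blast
  qed
  have "\<exists>F. \<forall>n. ?P n (F n) \<and> (\<exists>a. F (Suc n) = F n @ [a])"
    by (rule dependent_nat_choice[of ?P "\<lambda>_ p q. \<exists>a. q = p @ [a]"])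
      (use ne step in \<open>auto simp: ex_in_conv\<close>)
  then obtain F where F: "\<And>n. ?P n (F n)" "\<And>n. \<exists>a. F (Suc n) = F n @ [a]"
    by blast
  define w where "w n = last (F (Suc n))" for n
  have "F n = prefix n w" for n
  proof (induction n)
    case 0
    show ?case using F(1)[of 0] by auto
  next
    case (Suc n)
    then show ?case using F(2)[of n] by (auto simp: w_def)
  qed
  then have "\<exists>u\<in>S j. \<forall>n<j. u n = w n" for j
    using F(1)[of j] by (simp only: prefix_eq_iff)
  then show thesis
    by (rule that)
qed

section \<open>Concatenation of output blocks\<close>

lemma length_concat_prefix: "length (concat (prefix n v)) = (\<Sum>i<n. length (v i))"
  by (induction n) auto

lemma concat_prefix_map_nth:
  assumes "m < length (concat (prefix N v))"
  shows "\<exists>n. concat (prefix N (\<lambda>n. map (g n) (v n))) ! m = g n (concat (prefix N v) ! m)"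
  using assms
proof (induction N)
  case 0
  then show ?case by simp
next
  case (Suc N)
  have len: "length (concat (prefix N (\<lambda>n. map (g n) (v n)))) = length (concat (prefix N v))"
    by (simp add: length_concat_prefix)
  show ?case
  proof (cases "m < length (concat (prefix N v))")
    case True
    then show ?thesis
      using Suc.IH len by (simp add: nth_append)
  next
    case False
    then show ?thesis
      using Suc.prems len by (auto simp: nth_append)
  qed
qed

lemma concat_prefix_nth_mono:
  assumes "m < length (concat (prefix N v))" "N \<le> N'"
  shows "m < length (concat (prefix N' v))" "concat (prefix N' v) ! m = concat (prefix N v) ! m"
proof -
  obtain ws where "prefix N' v = prefix N v @ ws"
    using assms(2) by (metis le_add_diff_inverse subsequence_append)
  then show "m < length (concat (prefix N' v))"
    "concat (prefix N' v) ! m = concat (prefix N v) ! m"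
    using assms(1) by (auto simp: nth_append)
qed

lemma is_concat_exists:
  assumes "infinite_output v"
  obtains y where "is_concat v y"
proof -
  have "\<forall>m. \<exists>N. m < length (concat (prefix N v))"
    using assms unfolding infinite_output_def by (meson Suc_le_lessD)
  then obtain N where N: "\<And>m. m < length (concat (prefix (N m) v))"
    by metis
  have "concat (prefix n v) ! m = concat (prefix (N m) v) ! m"
    if "m < length (concat (prefix n v))" for n m
    using concat_prefix_nth_mono(2)[OF that] concat_prefix_nth_mono(2)[OF N]
    by (metis nat_le_linear)
  then have "is_concat v (\<lambda>m. concat (prefix (N m) v) ! m)"
    unfolding is_concat_def using assms by (auto intro!: nth_equalityI)
  then show thesis ..
qed

lemma is_concat_nth:
  assumes "is_concat v y" "m < length (concat (prefix n v))"
  shows "y m = concat (prefix n v) ! m"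
proof -
  have "concat (prefix n v) = prefix (length (concat (prefix n v))) y"
    using assms(1) by (auto simp: is_concat_def)
  then show ?thesis
    using assms(2) by (metis add_0 subsequence_nth diff_zero)
qed

text \<open>Renaming keeps block lengths, so position \<open>m\<close> stays in its block. Some
  \<open>n\<close> suffices later, as all maps used there agree on the datum of \<open>f x\<close>
  at the mismatch.\<close>

lemma is_concat_map_nth:
  assumes y: "is_concat v y" and y': "is_concat (\<lambda>n. map (g n) (v n)) y'"
  obtains n where "y' m = g n (y m)"
proof -
  let ?v' = "\<lambda>n. map (g n) (v n)"
  obtain N where N: "m < length (concat (prefix N v))"
    using y unfolding is_concat_def infinite_output_def by (meson Suc_le_lessD)
  then have N': "m < length (concat (prefix N ?v'))"
    by (simp add: length_concat_prefix)
  obtain n where "concat (prefix N ?v') ! m = g n (concat (prefix N v) ! m)"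
    using concat_prefix_map_nth[OF N] by metis
  then have "y' m = g n (y m)"
    using is_concat_nth[OF y N] is_concat_nth[OF y' N'] by simp
  then show thesis ..
qed

section \<open>Renaming data along runs\<close>

lemma sat_inj: "inj h \<Longrightarrow> sat (h \<circ> \<tau>) (h d) \<phi> \<longleftrightarrow> sat \<tau> d \<phi>"
  by (induction \<phi>) (auto simp: inj_eq)

text \<open>Tests only compare data for equality, and assignments and outputs only copy
  data.\<close>

lemma step_inj:
  assumes "step T c a w c'" "inj h"
  shows "step T (apsnd ((\<circ>) h) c) (apsnd h a) (map (apsnd h) w) (apsnd ((\<circ>) h) c')"
  using assms(1)
proof cases
  case (1 q \<sigma> \<phi> A w0 q' \<tau> d \<tau>')
  have "step T (q, h \<circ> \<tau>) (\<sigma>, h d) (map (\<lambda>(\<gamma>, r). (\<gamma>, (h \<circ> \<tau>') r)) w0) (q', h \<circ> \<tau>')"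
    using 1 assms(2) by (intro step.intros[of q \<sigma> \<phi> A]) (auto simp: sat_inj)
  moreover have "map (apsnd h) w = map (\<lambda>(\<gamma>, r). (\<gamma>, (h \<circ> \<tau>') r)) w0"
    using 1(3) by auto
  ultimately show ?thesis
    by (simp only: 1(1,2,4) apsnd_conv)
qed

text \<open>Agreement of \<open>g n\<close> and \<open>g (Suc n)\<close> on the old register
  contents lets the single injection \<open>g (Suc n)\<close> act on the whole step.\<close>

lemma steps_rename:
  assumes "step T (c n) (x n) (v n) (c (Suc n))" "inj (g (Suc n))"
    and "\<And>r. g (Suc n) (snd (c n) r) = g n (snd (c n) r)"
  shows "step T (apsnd ((\<circ>) (g n)) (c n)) (apsnd (g (Suc n)) (x n))
    (map (apsnd (g (Suc n))) (v n)) (apsnd ((\<circ>) (g (Suc n))) (c (Suc n)))"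
proof -
  have "apsnd ((\<circ>) (g n)) (c n) = apsnd ((\<circ>) (g (Suc n))) (c n)"
    using assms(3) by (cases "c n") auto
  then show ?thesis
    using step_inj[OF assms(1,2)] by (simp only:)
qed

lemma accepting_run_rename:
  assumes "accepting_run T d0 x c v" "\<And>n. inj (g n)" "g 0 d0 = d0"
    and "\<And>n r. g (Suc n) (snd (c n) r) = g n (snd (c n) r)"
  shows "accepting_run T d0 (\<lambda>n. apsnd (g (Suc n)) (x n)) (\<lambda>n. apsnd ((\<circ>) (g n)) (c n))
    (\<lambda>n. map (apsnd (g (Suc n))) (v n))"
  using assms steps_rename[of T c _ x v g] by (auto simp: accepting_run_def comp_def)

lemma finite_steps:
  assumes "finite (trans T)"
  shows "finite {(w, c'). step T c a w c'}"
proof -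
  let ?s = "\<lambda>(q, \<sigma>, \<phi>, A, w, q'). let \<tau>' = \<lambda>r. if r \<in> A then snd a else snd c r
    in (map (\<lambda>(\<gamma>, r). (\<gamma>, \<tau>' r)) w, (q', \<tau>'))"
  have "{(w, c'). step T c a w c'} \<subseteq> ?s ` trans T"
    by (force simp: step.simps Let_def)
  then show ?thesis
    using assms finite_subset by blast
qed

lemma step_valuation:
  assumes "is_nrt T" "step T c a w c'"
  shows "snd c' r = snd c r \<or> r \<in> regs T \<and> snd c' r = snd a"
  using assms(2,1) by cases (auto simp: is_nrt_def)

text \<open>Valuations are total; this ensures that registers outside \<open>regs T\<close>
  contribute no value but the initial one to those that must be tracked.\<close>

lemma run_unused_register:
  assumes "is_nrt T" "\<And>n. step T (c n) (x n) (v n) (c (Suc n))" "r \<notin> regs T"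
  shows "snd (c n) r = snd (c 0) r"
  by (induction n) (use step_valuation[OF assms(1,2)] assms(3) in metis)+

lemma inj_extend:
  assumes "inj h" "finite V" "infinite X \<or> card V < card X" "h ` V \<subseteq> X"
  obtains h' where "inj h'" "\<And>a. a \<in> V \<Longrightarrow> h' a = h a" "h' e \<in> X"
proof (cases "e \<in> V")
  case True
  then show thesis using assms that by blast
next
  case False
  have "\<not> X \<subseteq> h ` V"
    using assms(2,3) by (metis card_image_le card_mono finite_imageI finite_subset leD le_trans)
  then obtain b where b: "b \<in> X" "b \<notin> h ` V"
    by blast
  show thesis
  proof (rule that)
    show "inj (transpose (h e) b \<circ> h)"
      using assms(1) by (intro inj_compose) auto
    show "(transpose (h e) b \<circ> h) a = h a" if "a \<in> V" for a
      using that b False assms(1) by (auto simp: transpose_def inj_eq)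
    show "(transpose (h e) b \<circ> h) e \<in> X"
      using b by simp
  qed
qed

lemma rename_into:
  fixes V :: "nat \<Rightarrow> 'd set" and x :: "nat \<Rightarrow> 'd"
  assumes fin: "\<And>n. finite (V n)" and card: "\<And>n. infinite X \<or> card (V n) < card X"
    and V0: "V 0 = {d0, d}" and VSuc: "\<And>n. V (Suc n) \<subseteq> insert (x n) (V n)" and "d0 \<in> X"
  obtains h where "\<And>n. inj (h n)" "h 0 d0 = d0" "\<And>n a. a \<in> V n \<Longrightarrow> h (Suc n) a = h n a"
    "\<And>n. h (Suc n) (x n) \<in> X"
proof -
  let ?P = "\<lambda>n h. inj h \<and> h ` V n \<subseteq> X \<and> (n = 0 \<longrightarrow> h d0 = d0)"
  let ?Q = "\<lambda>n h h'. (\<forall>a\<in>V n. h' a = h a) \<and> h' (x n) \<in> X"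
  \<comment> \<open>The first renaming modifies the identity: it fixes \<open>d0\<close> and sends
    \<open>d\<close> into \<open>X\<close>.\<close>
  have "card {d0} \<le> card (V 0)"
    using fin V0 by (intro card_mono) auto
  then have "infinite X \<or> card {d0} < card X"
    using card[of 0] by linarith
  then obtain h0 where "inj h0" "h0 d0 = d0" "h0 d \<in> X"
    using inj_extend[of id "{d0}" X d] \<open>d0 \<in> X\<close> by auto
  then have base: "?P 0 h0"
    using V0 \<open>d0 \<in> X\<close> by auto
  have step: "\<exists>h'. ?P (Suc n) h' \<and> ?Q n h h'" if "?P n h" for n h
  proof -
    have "inj h" "h ` V n \<subseteq> X"
      using that by auto
    then obtain h' where h': "inj h'" "\<And>a. a \<in> V n \<Longrightarrow> h' a = h a" "h' (x n) \<in> X"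
      using inj_extend[OF _ fin card] by metis
    then have "h' ` V (Suc n) \<subseteq> X"
      using \<open>h ` V n \<subseteq> X\<close> VSuc[of n] by fastforce
    then show ?thesis
      using h' by (intro exI[of _ h']) simp
  qed
  have "\<exists>h. \<forall>n. ?P n (h n) \<and> ?Q n (h n) (h (Suc n))"
    by (rule dependent_nat_choice[of ?P ?Q]) (use base step in blast)+
  then obtain h where "\<forall>n. ?P n (h n) \<and> ?Q n (h n) (h (Suc n))" ..
  then show thesis
    by (intro that[of h]) blast+
qed

section \<open>Discontinuity on few data values\<close>

text \<open>Runs on inputs sharing \<open>n\<close> letters with \<open>x\<close> reach finitely
  many configurations at time \<open>n\<close>, so Koenig's lemma applies. The limit itself may be
  neither accepting nor satisfy \<open>P\<close>; the last conclusion ties it to runs that do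
  both.\<close>

lemma limit_run:
  fixes T :: "('q, 'r, 'a::finite, 'b::finite) transducer"
  assumes "finite (trans T)"
    and ex: "\<And>j. \<exists>y c v. accepting_run T d0 y c v \<and> P y c v \<and> (\<forall>i<j. x i = y i)"
  obtains c' v' where "c' 0 = (init T, \<lambda>_. d0)"
    "\<And>n. step T (c' n) (x n) (v' n) (c' (Suc n))"
    "\<And>j. \<exists>y c v. accepting_run T d0 y c v \<and> P y c v \<and> (\<forall>i<j. x i = y i) \<and> (\<forall>i\<le>j. c i = c' i)"
proof -
  define R where "R j y c v \<longleftrightarrow> accepting_run T d0 y c v \<and> P y c v \<and> (\<forall>i<j. x i = y i)" for j y c v
  \<comment> \<open>A run is coded by its output blocks paired with the configurations after each
    step; the initial configuration is common to all.\<close>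
  define S where "S j = {(\<lambda>n. (v n, c (Suc n))) | y c v. R j y c v}" for j
  define C where "C n = {c n | y c v. R n y c v}" for n
  have step_in: "(v n, c (Suc n)) \<in> (\<Union>e\<in>C n. {(w, e'). step T e (x n) w e'})"
    if "R (Suc n) y c v" for n y c v
  proof
    show "c n \<in> C n"
      using that unfolding C_def R_def by (intro CollectI exI[of _ y] exI[of _ c] exI[of _ v]) simp
    show "(v n, c (Suc n)) \<in> {(w, e'). step T (c n) (x n) w e'}"
      using that by (simp add: R_def accepting_run_def)
  qed
  have finC: "finite (C n)" for n
  proof (induction n)
    case 0
    have "C 0 \<subseteq> {(init T, \<lambda>_. d0)}"
      by (auto simp: C_def R_def accepting_run_def)
    then show ?case using finite_subset by blast
  next
    case (Suc n)
    have "C (Suc n) \<subseteq> snd ` (\<Union>e\<in>C n. {(w, e'). step T e (x n) w e'})"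
    proof
      fix e assume "e \<in> C (Suc n)"
      then obtain y c v where "R (Suc n) y c v" "e = c (Suc n)"
        by (auto simp: C_def)
      then show "e \<in> snd ` (\<Union>e\<in>C n. {(w, e'). step T e (x n) w e'})"
        using image_eqI[OF _ step_in, of e snd] by simp
    qed
    then show ?case
      using Suc finite_steps[OF assms(1)] by (meson finite_UN finite_imageI finite_subset)
  qed
  have "finite ((\<lambda>w. w n) ` S (Suc n))" for n
  proof -
    have "(\<lambda>w. w n) ` S (Suc n) \<subseteq> (\<Union>e\<in>C n. {(w, e'). step T e (x n) w e'})"
      unfolding S_def using step_in by (intro image_subsetI) (elim CollectE exE conjE, simp only:)
    then show ?thesis
      using finC finite_steps[OF assms(1)] by (meson finite_UN finite_subset)
  qed
  moreover have "S j \<subseteq> S i" if "i \<le> j" for i j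
    using that by (fastforce simp: S_def R_def)
  moreover have "S j \<noteq> {}" for j
    using ex[of j] by (auto simp: S_def R_def)
  ultimately obtain w where w: "\<And>j. \<exists>u\<in>S j. \<forall>n<j. u n = w n"
    using koenig_sequences[of S] by blast
  \<comment> \<open>Restores the initial configuration left out of the coding.\<close>
  define c' where "c' n = (case n of 0 \<Rightarrow> (init T, \<lambda>_. d0) | Suc l \<Rightarrow> snd (w l))" for n
  have run: "\<exists>y c v. R j y c v \<and> (\<forall>i\<le>j. c i = c' i) \<and> (\<forall>i<j. v i = fst (w i))" for j
  proof -
    obtain y c v where *: "R j y c v" "\<forall>n<j. (v n, c (Suc n)) = w n"
      using w[of j] by (auto simp: S_def)
    have "c i = c' i" if "i \<le> j" for i
    proof (cases i)
      case 0
      then show ?thesis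
        using *(1) by (simp add: c'_def R_def accepting_run_def)
    next
      case (Suc l)
      then have "(v l, c i) = w l"
        using *(2) that by simp
      then show ?thesis
        using Suc by (cases "w l") (simp add: c'_def)
    qed
    then show ?thesis
      using * by (metis fst_conv)
  qed
  show thesis
  proof (rule that[of c' "\<lambda>n. fst (w n)"])
    show "c' 0 = (init T, \<lambda>_. d0)"
      by (simp add: c'_def)
    show "step T (c' n) (x n) (fst (w n)) (c' (Suc n))" for n
    proof -
      obtain y c v where *: "R (Suc n) y c v" "\<forall>i\<le>Suc n. c i = c' i" "\<forall>i<Suc n. v i = fst (w i)"
        using run by blast
      from *(1) have "step T (c n) (x n) (v n) (c (Suc n))"
        by (simp add: R_def accepting_run_def)
      then show ?thesis
        using *(2,3) by simp
    qed
    show "\<exists>y c v. accepting_run T d0 y c v \<and> P y c v \<and> (\<forall>i<j. x i = y i) \<and> (\<forall>i\<le>j. c i = c' i)" for j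
      using run[of j] unfolding R_def by blast
  qed
qed

lemma accepting_run_image:
  assumes "defines_fun T d0 f" "productive T d0" "accepting_run T d0 x c v"
  obtains y where "f x = Some y" "is_concat v y"
proof -
  obtain y where "is_concat v y"
    using assms(2,3) is_concat_exists unfolding productive_def by blast
  moreover have "(x, y) \<in> Map.graph f"
    using assms(1,3) calculation unfolding defines_fun_def behaviour_def by blast
  ultimately show thesis
    using that by (auto simp: in_graphD)
qed

lemma image_accepting_run:
  assumes "defines_fun T d0 f" "f x = Some y"
  obtains c v where "accepting_run T d0 x c v" "is_concat v y"
  using assms in_graphI[of f x y] unfolding defines_fun_def behaviour_def by blast

lemma discontinuous_on_few_data:
  fixes T :: "('q, 'r, 'a::finite, 'b::finite) transducer"
    and f :: "('a \<times> 'd) word \<rightharpoonup> ('b \<times> 'd) word"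
  assumes nrt: "is_nrt T" and prod: "productive T d0" and df: "defines_fun T d0 f"
    and X: "infinite X \<or> card X \<ge> 2 * card (regs T) + 3" and "d0 \<in> X"
    and "x \<in> dom f" and disc: "\<not> continuous_at f x"
  shows "\<exists>z \<in> dom f. (\<forall>n. snd (z n) \<in> X) \<and> \<not> continuous_at f z"
proof -
  obtain y where y: "f x = Some y"
    using \<open>x \<in> dom f\<close> by blast
  then obtain c v where run: "accepting_run T d0 x c v" and out: "is_concat v y"
    using image_accepting_run df by metis
  obtain m where m: "\<And>j. \<exists>x'\<in>dom f. (\<forall>i<j. x i = x' i) \<and> y m \<noteq> the (f x') m"
    using disc y unfolding continuous_at_pointwise by auto
  let ?P = "\<lambda>x' c' v'. \<exists>y'. is_concat v' y' \<and> y m \<noteq> y' m"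
  have ex: "\<exists>x' c' v'. accepting_run T d0 x' c' v' \<and> ?P x' c' v' \<and> (\<forall>i<j. x i = x' i)" for j
    using m[of j] image_accepting_run[OF df] by (metis domD option.sel)
  have "finite (trans T)" "finite (regs T)"
    using nrt by (auto simp: is_nrt_def)
  obtain c' v' where run': "c' 0 = (init T, \<lambda>_. d0)" "\<And>n. step T (c' n) (x n) (v' n) (c' (Suc n))"
    and lim: "\<And>j. \<exists>x2 c2 v2. accepting_run T d0 x2 c2 v2 \<and> ?P x2 c2 v2 \<and> (\<forall>i<j. x i = x2 i) \<and>
      (\<forall>i\<le>j. c2 i = c' i)"
    using limit_run[of T d0 ?P x, OF \<open>finite (trans T)\<close> ex] by metis
  have run0: "c 0 = (init T, \<lambda>_. d0)" "\<And>n. step T (c n) (x n) (v n) (c (Suc n))"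
    using run by (auto simp: accepting_run_def)
  obtain \<gamma> d where ym: "y m = (\<gamma>, d)"
    by fastforce
  \<comment> \<open>\<open>d0\<close> also covers registers outside \<open>regs T\<close>; including
    \<open>d\<close> makes all renamings agree on it.\<close>
  define V where "V n = {d0, d} \<union> snd (c n) ` regs T \<union> snd (c' n) ` regs T" for n
  have inV: "snd (c n) r \<in> V n" "snd (c' n) r \<in> V n" for n r
    using run_unused_register[of T c x v r n] run_unused_register[of T c' x v' r n]
      nrt run0(2) run'(2) run0(1) run'(1) by (auto simp: V_def)
  have finV: "finite (V n)" for n
    using \<open>finite (regs T)\<close> by (auto simp: V_def)
  have cardV: "card (V n) \<le> 2 * card (regs T) + 2" for n
  proof -
    have "card (V n) \<le> card {d0, d} + card (snd (c n) ` regs T) + card (snd (c' n) ` regs T)"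
      unfolding V_def by (meson add_le_mono1 card_Un_le le_trans)
    also have "\<dots> \<le> 2 + card (regs T) + card (regs T)"
      using \<open>finite (regs T)\<close> by (intro add_mono card_image_le) (auto simp: card_insert_if)
    finally show ?thesis by simp
  qed
  have V0: "V 0 = {d0, d}"
    using run0(1) run'(1) by (auto simp: V_def)
  have VSuc: "V (Suc n) \<subseteq> insert (snd (x n)) (V n)" for n
  proof -
    have "snd (c (Suc n)) r \<in> insert (snd (x n)) (V n)"
      "snd (c' (Suc n)) r \<in> insert (snd (x n)) (V n)" for r
      using step_valuation[OF nrt run0(2)[of n], of r] step_valuation[OF nrt run'(2)[of n], of r]
        inV[of n r] by auto
    moreover have "{d0, d} \<subseteq> V n"
      by (simp add: V_def)
    ultimately show ?thesis
      unfolding V_def[of "Suc n"] by blast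
  qed
  \<comment> \<open>At least one element of \<open>X\<close> stays free for the incoming
    datum.\<close>
  have cardVX: "infinite X \<or> card (V n) < card X" for n
    using X cardV[of n] by linarith
  obtain h where inj: "\<And>n. inj (h n)" and h0: "h 0 d0 = d0"
    and hSuc: "\<And>n a. a \<in> V n \<Longrightarrow> h (Suc n) a = h n a" and hX: "\<And>n. h (Suc n) (snd (x n)) \<in> X"
    by (rule rename_into[where V = V and X = X and x = "\<lambda>n. snd (x n)",
        OF finV cardVX V0 VSuc \<open>d0 \<in> X\<close>]) blast
  have hd: "h n d = h 0 d" for n
    by (induction n) (auto simp: hSuc V_def)
  define z where "z n = apsnd (h (Suc n)) (x n)" for n
  let ?v = "\<lambda>n. map (apsnd (h (Suc n))) (v n)"
  have "accepting_run T d0 z (\<lambda>n. apsnd ((\<circ>) (h n)) (c n)) ?v"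
    unfolding z_def by (rule accepting_run_rename[where g = h, OF run inj h0 hSuc[OF inV(1)]])
  then obtain yz where yz: "f z = Some yz" "is_concat ?v yz"
    by (rule accepting_run_image[OF df prod])
  then obtain n where "yz m = apsnd (h (Suc n)) (y m)"
    using is_concat_map_nth[OF out, of "\<lambda>n. apsnd (h (Suc n))" yz m] by blast
  then have yzm: "yz m = (\<gamma>, h 0 d)"
    using ym hd by simp
  have mismatch: "\<exists>x'\<in>dom f. (\<forall>i<j. z i = x' i) \<and> yz m \<noteq> the (f x') m" for j
  proof -
    obtain x2 c2 v2 y2 where *: "accepting_run T d0 x2 c2 v2" "is_concat v2 y2" "y m \<noteq> y2 m"
      "\<And>i. i < j \<Longrightarrow> x i = x2 i" "\<And>i. i \<le> j \<Longrightarrow> c2 i = c' i"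
      using lim[of j] by blast
    \<comment> \<open>Past \<open>j\<close> the run \<open>c2\<close> may leave \<open>c'\<close>,
      and \<open>V\<close> no longer controls its registers; a renaming frozen at \<open>h j\<close>
      agrees with itself there.\<close>
    define g where "g n = h (min n j)" for n
    have gSuc: "g (Suc n) (snd (c2 n) r) = g n (snd (c2 n) r)" for n r
    proof (cases "n < j")
      case True
      then show ?thesis using hSuc[OF inV(2)] *(5)[of n] by (simp add: g_def min_def)
    next
      case False
      then show ?thesis by (simp add: g_def min_def)
    qed
    let ?x' = "\<lambda>n. apsnd (g (Suc n)) (x2 n)"
    let ?v' = "\<lambda>n. map (apsnd (g (Suc n))) (v2 n)"
    have "accepting_run T d0 ?x' (\<lambda>n. apsnd ((\<circ>) (g n)) (c2 n)) ?v'"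
      using inj h0 by (intro accepting_run_rename[where g = g, OF *(1)] gSuc) (auto simp: g_def)
    then obtain y' where y': "f ?x' = Some y'" "is_concat ?v' y'"
      by (rule accepting_run_image[OF df prod])
    then obtain n where "y' m = apsnd (g (Suc n)) (y2 m)"
      using is_concat_map_nth[OF *(2), of "\<lambda>n. apsnd (g (Suc n))" y' m] by blast
    \<comment> \<open>The index \<open>n\<close> of the other run works here too, since
      \<open>d\<close> is renamed alike at all times. One injection then separates
      \<open>y m\<close> from \<open>y2 m\<close>, whatever datum \<open>y2 m\<close>
      carries.\<close>
    moreover have "yz m = apsnd (g (Suc n)) (y m)"
      using yzm ym hd[of "min (Suc n) j"] by (simp add: g_def)
    moreover have "inj (apsnd (g (Suc n)) :: 'b \<times> 'd \<Rightarrow> _)"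
      using inj by (auto simp: g_def inj_def)
    ultimately have "yz m \<noteq> y' m"
      using *(3) by (simp add: inj_eq)
    \<comment> \<open>Here \<open>Suc i \<le> j\<close>, so \<open>g (Suc i)\<close> is still
      \<open>h (Suc i)\<close>.\<close>
    moreover have "z i = ?x' i" if "i < j" for i
      using that *(4) by (simp add: z_def g_def min_def)
    ultimately show ?thesis
      using y'(1) by (intro bexI[of _ ?x']) auto
  qed
  have "\<not> continuous_at f z"
  proof
    assume "continuous_at f z"
    then obtain j where "\<forall>x'\<in>dom f. (\<forall>i<j. z i = x' i) \<longrightarrow> the (f z) m = the (f x') m"
      unfolding continuous_at_pointwise by blast
    then show False
      using mismatch[of j] by (simp only: yz(1) option.sel) blast
  qed
  moreover have "snd (z n) \<in> X" for n
    using hX by (simp add: z_def)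
  ultimately show ?thesis
    using yz(1) by blast
qed

theorem theorem6:
  fixes T :: "('q, 'r, 'a::finite, 'b::finite) transducer"
    and d0 :: "'d::{countable, infinite}"
    and f :: "('a \<times> 'd) word \<rightharpoonup> ('b \<times> 'd) word"
    and k :: nat
    and X :: "'d set"
  assumes "is_nrt T"
    and "card (regs T) = k"
    and "productive T d0"
    and "defines_fun T d0 f"
    and "infinite X \<or> card X \<ge> 2 * k + 3"
    and "d0 \<in> X"
  shows "(\<exists>x \<in> dom f. \<not> continuous_at f x) \<longleftrightarrow>
         (\<exists>z \<in> dom f. (\<forall>n. snd (z n) \<in> X) \<and> \<not> continuous_at f z)"
  using discontinuous_on_few_data[OF assms(1,3,4) _ assms(6)] assms(2,5) by blast

end
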